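(* In the setting of the context, assuming $A_{2m-1}C_{2m+2}=C_{2m}A_{2m+3}$ for all integers $2\le m\le\lfloor M/2\rfloor-2$, the charges mutually commute: $[Q_M^{(k)},Q_M^{(l)}]=0$ for all integers $k,l\ge 0$.
   Context: Extended FFD setting. Fix an integer $M\ge 1$ and complex numbers $b_1,\dots,b_M$ and $\bar b_{2m+1}$ for $0\le m\le\lfloor M/2\rfloor$. Let $\mathcal{A}$ be a unital associative complex algebra containing elements $h_1,\dots,h_M$ and $\bar h_{1},\bar h_3,\dots,\bar h_{2\lfloor M/2\rfloor+1}$ (the "generators"; write $h_{\overline{2m+1}}:=\bar h_{2m+1}$), with $h_j^2=b_j^2\,\mathbb{1}$ and $\bar h_{2m+1}^2=\bar b_{2m+1}^2\,\mathbb{1}$. Define the frustration graph $G_M=(V_M,E_M)$ whose vertices are the generators and whose edges are: $h_i\sim h_j$ iff $|i-j|\in\{1,2\}$; $\bar h_{2m-1}\sim h_j$ iff $j\in\{2m-7,2m-5,2m-3,2m-1,2m-2,2m\}$; $\bar h_{2m-1}\sim\bar h_{2m'-1}$ iff $|m-m'|=1$. Assume adjacent generators anticommute and distinct non-adjacent generators commute. Any symbol $h_j$ or $\bar h_j$ whose index lies outside the ranges above denotes $0$. Define $A_{2m-1}:=h_{2m}h_{2m-3}+h_{2m-2}\bar h_{2m+1}$ and $C_{2m}:=h_{2m-3}\bar h_{2m+3}$. An independent set is a set of vertices of $G_M$ no two of which are adjacent; for an independent set $S$, $h_S:=\prod_{v\in S}h_v$ (the factors commute, so the order is irrelevant), $h_\emptyset=\mathbb{1}$.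 The charges are $Q_M^{(k)}:=\sum_{S\text{ independent},\,|S|=k}h_S$ ($Q_M^{(0)}=\mathbb{1}$), and $H_M:=Q_M^{(1)}=\sum_{j=1}^M h_j+\sum_{m=0}^{\lfloor M/2\rfloor}\bar h_{2m+1}$. *)

theory Defs
  imports Complex_Main "HOL-Library.Product_Lexorder"
begin

text \<open>Generators are encoded as pairs: (False, j) is h_j, (True, j) is the barred
  generator bar h_j (only odd j occur).\<close>

type_synonym gen = "bool \<times> int"

definition ffd_V :: "nat \<Rightarrow> gen set" where
  "ffd_V M = {(False, j) | j. 1 \<le> j \<and> j \<le> int M}
           \<union> {(True, 2 * m + 1) | m. 0 \<le> m \<and> m \<le> int (M div 2)}"

fun ffd_edge0 :: "gen \<Rightarrow> gen \<Rightarrow> bool" where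
  "ffd_edge0 (False, i) (False, j) = (\<bar>i - j\<bar> \<in> {1, 2})"
| "ffd_edge0 (True, k) (False, j) =
     (\<exists>m. k = 2 * m - 1 \<and> j \<in> {2*m-7, 2*m-5, 2*m-3, 2*m-1, 2*m-2, 2*m})"
| "ffd_edge0 (True, k) (True, k') =
     (\<exists>m m'. k = 2 * m - 1 \<and> k' = 2 * m' - 1 \<and> \<bar>m - m'\<bar> = 1)"
| "ffd_edge0 (False, j) (True, k) = False"

definition ffd_adj :: "nat \<Rightarrow> gen \<Rightarrow> gen \<Rightarrow> bool" where
  "ffd_adj M u v \<longleftrightarrow> u \<in> ffd_V M \<and> v \<in> ffd_V M \<and> (ffd_edge0 u v \<or> ffd_edge0 v u)"

definition ffd_indep :: "nat \<Rightarrow> gen set \<Rightarrow> bool" where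
  "ffd_indep M S \<longleftrightarrow> S \<subseteq> ffd_V M \<and> (\<forall>u\<in>S. \<forall>v\<in>S. \<not> ffd_adj M u v)"

text \<open>h_S: product of the (pairwise commuting) factors, taken in a fixed order.\<close>
definition ffd_hS :: "(gen \<Rightarrow> 'a::ring_1) \<Rightarrow> gen set \<Rightarrow> 'a" where
  "ffd_hS g S = prod_list (map g (sorted_list_of_set S))"

definition ffd_Q :: "nat \<Rightarrow> (gen \<Rightarrow> 'a::ring_1) \<Rightarrow> nat \<Rightarrow> 'a" where
  "ffd_Q M g k = (\<Sum>S \<in> {S. ffd_indep M S \<and> card S = k}. ffd_hS g S)"

definition ffd_h :: "nat \<Rightarrow> (gen \<Rightarrow> 'a::ring_1) \<Rightarrow> int \<Rightarrow> 'a" where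
  "ffd_h M g j = (if (False, j) \<in> ffd_V M then g (False, j) else 0)"

definition ffd_hb :: "nat \<Rightarrow> (gen \<Rightarrow> 'a::ring_1) \<Rightarrow> int \<Rightarrow> 'a" where
  "ffd_hb M g j = (if (True, j) \<in> ffd_V M then g (True, j) else 0)"

text \<open>A_{2m-1} and C_{2m}, indexed by m.\<close>
definition ffd_A :: "nat \<Rightarrow> (gen \<Rightarrow> 'a::ring_1) \<Rightarrow> int \<Rightarrow> 'a" where
  "ffd_A M g m = ffd_h M g (2*m) * ffd_h M g (2*m-3) + ffd_h M g (2*m-2) * ffd_hb M g (2*m+1)"

definition ffd_C :: "nat \<Rightarrow> (gen \<Rightarrow> 'a::ring_1) \<Rightarrow> int \<Rightarrow> 'a" where
  "ffd_C M g m = ffd_h M g (2*m-3) * ffd_hb M g (2*m+3)"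

text \<open>A unital associative complex algebra structure on a ring: a unital ring
  homomorphism from the complex numbers into the centre.\<close>
definition cplx_alg :: "(complex \<Rightarrow> 'a::ring_1) \<Rightarrow> bool" where
  "cplx_alg sc \<longleftrightarrow> sc 1 = 1 \<and> (\<forall>x y. sc (x + y) = sc x + sc y)
     \<and> (\<forall>x y. sc (x * y) = sc x * sc y) \<and> (\<forall>c a. sc c * a = a * sc c)"

end

theory Submission
  imports Defs
begin

text \<open>
  Relabel the generators as \<open>E\<^sub>n = h\<^bsub>2n\<^esub>\<close>, \<open>c\<^bsub>2n\<^esub> = h\<^bsub>2n-1\<^esub>\<close> and \<open>c\<^bsub>2n-1\<^esub> = hbar\<^bsub>2n+1\<^esub>\<close>, extended by zero. Then
  \<open>c\<^sub>i\<close> and \<open>c\<^sub>j\<close> anticommute iff \<open>0 < |i - j| \<le> 3\<close>, and the graph splits into triangles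
  with sums \<open>K\<^sub>n = E\<^sub>n + c\<^bsub>2n-1\<^esub> + c\<^bsub>2n\<^esub>\<close>. These satisfy \<open>{K\<^sub>n, K\<^bsub>n-1\<^esub>} = 2 A\<^sub>n\<close>, \<open>[K\<^bsub>n-2\<^esub>, K\<^sub>n] = 2 C\<^bsub>n-1\<^esub>\<close>,
  with \<open>A\<^sub>n\<close> and \<open>C\<^sub>n\<close> the elements \<open>A\<^bsub>2n-1\<^esub>\<close> and \<open>C\<^bsub>2n\<^esub>\<close> of the hypothesis. The generating function
  \<open>q\<^sub>n\<close> (in a central variable \<open>u\<close>) of the charges of the first blocks obeys \<open>q\<^sub>n = q\<^bsub>n-1\<^esub> + u X\<^sub>n\<close>,
  where \<open>2 X\<^sub>n = {K\<^sub>n, q\<^bsub>n-1\<^esub>}\<close>.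

  Primes denote the same objects for a second central variable \<open>v\<close>. Since \<open>K\<^sub>n\<^sup>2\<close> is central,
  \<open>[q\<^sub>n, q'\<^sub>n] = 0\<close> follows from \<open>[q\<^bsub>n-1\<^esub>, q'\<^bsub>n-1\<^esub>] = 0\<close> and \<open>u [X\<^sub>n, q'\<^bsub>n-1\<^esub>] = v [X'\<^sub>n, q\<^bsub>n-1\<^esub>]\<close>. The latter is
  propagated from \<open>n\<close> to \<open>n + 1\<close>; the obstruction is \<open>F\<^sub>n + A\<^bsub>n+1\<^esub> G\<^bsub>n-1\<^esub>\<close>, where \<open>F\<close> and \<open>G\<close> measure the
  asymmetry of \<open>{C\<^sub>n q\<^bsub>n-3\<^esub>, q'\<^bsub>n-1\<^esub>}\<close> in \<open>u\<close> and \<open>v\<close>. Both obey recursions with the same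
  inhomogeneous term, so that the relation between the \<open>A\<close> and the \<open>C\<close> makes the obstruction vanish.
\<close>

section \<open>Commutation relations between blocks\<close>

abbreviation commutator :: "'a::ring_1 \<Rightarrow> 'a \<Rightarrow> 'a" where "commutator x y \<equiv> x * y - y * x"
abbreviation anticommutator :: "'a::ring_1 \<Rightarrow> 'a \<Rightarrow> 'a" where "anticommutator x y \<equiv> x * y + y * x"

definition commutes :: "'a::ring_1 \<Rightarrow> 'a \<Rightarrow> bool" where "commutes x y \<longleftrightarrow> x * y = y * x"
definition anticommutes :: "'a::ring_1 \<Rightarrow> 'a \<Rightarrow> bool" where "anticommutes x y \<longleftrightarrow> x * y = - (y * x)"

lemma commutes_sym: "commutes x y \<Longrightarrow> commutes y x" by (simp add: commutes_def)
lemma anticommutes_sym: "anticommutes x y \<Longrightarrow> anticommutes y x" by (simp add: anticommutes_def)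

lemma sign_rules:
  "commutes x y \<Longrightarrow> commutes x z \<Longrightarrow> commutes x (y * z)"
  "commutes x y \<Longrightarrow> anticommutes x z \<Longrightarrow> anticommutes x (y * z)"
  "anticommutes x y \<Longrightarrow> commutes x z \<Longrightarrow> anticommutes x (y * z)"
  "anticommutes x y \<Longrightarrow> anticommutes x z \<Longrightarrow> commutes x (y * z)"
  "commutes x y \<Longrightarrow> commutes x z \<Longrightarrow> commutes x (y + z)"
  "anticommutes x y \<Longrightarrow> anticommutes x z \<Longrightarrow> anticommutes x (y + z)"
  unfolding commutes_def anticommutes_def
  by (simp_all add: distrib_left distrib_right mult.assoc [symmetric])
     (simp_all add: mult.assoc)

lemma sign_rules_left:
  "commutes y x \<Longrightarrow> commutes z x \<Longrightarrow> commutes (y * z) x"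
  "commutes y x \<Longrightarrow> anticommutes z x \<Longrightarrow> anticommutes (y * z) x"
  "anticommutes y x \<Longrightarrow> commutes z x \<Longrightarrow> anticommutes (y * z) x"
  "anticommutes y x \<Longrightarrow> anticommutes z x \<Longrightarrow> commutes (y * z) x"
  "commutes y x \<Longrightarrow> commutes z x \<Longrightarrow> commutes (y + z) x"
  "anticommutes y x \<Longrightarrow> anticommutes z x \<Longrightarrow> anticommutes (y + z) x"
  by (meson sign_rules commutes_sym anticommutes_sym)+

lemma commutesD: "commutes x y \<Longrightarrow> x * y = y * x" "commutes x y \<Longrightarrow> x * (y * w) = y * (x * w)"
  by (simp_all add: commutes_def mult.assoc [symmetric])
lemma anticommutesD: "anticommutes x y \<Longrightarrow> x * y = - (y * x)" "anticommutes x y \<Longrightarrow> x * (y * w) = - (y * (x * w))"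
  by (simp_all add: anticommutes_def mult.assoc [symmetric])

text \<open>Among the nine pairs of generators from the adjacent blocks \<open>n\<close> and
  \<open>n-1\<close>, exactly two commute; \<open>blockA\<close> collects them. Between blocks at
  distance two all pairs commute except one, and its product is \<open>blockC\<close>.\<close>

definition blockK :: "(int \<Rightarrow> 'a::ring_1) \<Rightarrow> (int \<Rightarrow> 'a) \<Rightarrow> int \<Rightarrow> 'a" where
  "blockK E c n = E n + c (2*n-1) + c (2*n)"
definition blockA :: "(int \<Rightarrow> 'a::ring_1) \<Rightarrow> (int \<Rightarrow> 'a) \<Rightarrow> int \<Rightarrow> 'a" where
  "blockA E c n = E n * c (2*n-2) + c (2*n-1) * E (n-1)"
definition blockC :: "(int \<Rightarrow> 'a::ring_1) \<Rightarrow> int \<Rightarrow> 'a" where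
  "blockC c n = c (2*n-2) * c (2*n+1)"

locale ffd_blocks =
  fixes E c :: "int \<Rightarrow> 'a::ring_1"
  assumes cc_anticommutes: "i \<noteq> j \<Longrightarrow> \<bar>i - j\<bar> \<le> 3 \<Longrightarrow> anticommutes (c i) (c j)"
    and cc_commutes: "3 < \<bar>i - j\<bar> \<Longrightarrow> commutes (c i) (c j)"
    and Ec_anticommutes: "i - 2*n \<in> {-3,-1,0,2} \<Longrightarrow> anticommutes (E n) (c i)"
    and Ec_commutes: "i - 2*n \<notin> {-3,-1,0,2} \<Longrightarrow> commutes (E n) (c i)"
    and EE_anticommutes: "\<bar>m - n\<bar> = 1 \<Longrightarrow> anticommutes (E m) (E n)"
    and EE_commutes: "1 < \<bar>m - n\<bar> \<Longrightarrow> commutes (E m) (E n)"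
    and E_sq: "commutes (E n * E n) x"
    and c_sq: "commutes (c i * c i) x"
    and E_neg: "n < 0 \<Longrightarrow> E n = 0"
    and c_neg: "i < -1 \<Longrightarrow> c i = 0"
    and AC: "blockA E c m * blockC c (m+1) = blockC c m * blockA E c (m+2)"
begin

abbreviation "K \<equiv> blockK E c"
abbreviation "A \<equiv> blockA E c"
abbreviation "C \<equiv> blockC c"

lemmas gens = cc_anticommutes cc_commutes Ec_anticommutes Ec_commutes EE_anticommutes EE_commutes
  Ec_anticommutes [THEN anticommutes_sym] Ec_commutes [THEN commutes_sym]

text \<open>Commuting with each of the three members separately, not only with their sum
  \<open>K k\<close>: the products \<open>A\<close> and \<open>C\<close> single out individual
  members of a block.\<close>

definition block_commutes :: "'a \<Rightarrow> int \<Rightarrow> bool" where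
  "block_commutes x k \<longleftrightarrow> commutes x (E k) \<and> commutes x (c (2*k-1)) \<and> commutes x (c (2*k))"
definition block_anticommutes :: "'a \<Rightarrow> int \<Rightarrow> bool" where
  "block_anticommutes x k \<longleftrightarrow> anticommutes x (E k) \<and> anticommutes x (c (2*k-1)) \<and> anticommutes x (c (2*k))"

lemma c_self: "i = j \<Longrightarrow> commutes (c i) (c j)" and E_self: "i = j \<Longrightarrow> commutes (E i) (E j)" by (simp_all add: commutes_def)

text \<open>Each product of two generators in \<open>A n\<close> or \<open>C n\<close> meets all
  members of a nearby block with the same sign. The sign tables in this and the following lemmas
  therefore depend on the block alone.\<close>

lemma A_block_commutes: "k \<le> n - 3 \<or> k \<in> {n-1, n, n+2} \<Longrightarrow> block_commutes (A n) k"
  unfolding block_commutes_def blockA_def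
  by (elim disjE insertE emptyE; (intro conjI sign_rules_left; (rule gens c_self E_self; force)))

lemma A_block_anticommutes: "k \<in> {n-2, n+1} \<Longrightarrow> block_anticommutes (A n) k"
  unfolding block_anticommutes_def blockA_def
  by (elim disjE insertE emptyE; (intro conjI sign_rules_left; (rule gens c_self E_self; force)))

lemma C_block_commutes: "k \<le> n - 3 \<or> k \<in> {n, n+3} \<Longrightarrow> block_commutes (C n) k"
  unfolding block_commutes_def blockC_def
  by (elim disjE insertE emptyE; (intro conjI sign_rules_left; (rule gens c_self E_self; force)))

lemma C_block_anticommutes: "k \<in> {n-2, n-1, n+1, n+2} \<Longrightarrow> block_anticommutes (C n) k"
  unfolding block_anticommutes_def blockC_def
  by (elim disjE insertE emptyE; (intro conjI sign_rules_left; (rule gens c_self E_self; force)))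

lemma K_block_commutes: "k \<le> n - 3 \<Longrightarrow> block_commutes (K n) k"
  unfolding block_commutes_def blockK_def
  by (intro conjI sign_rules_left; (rule gens c_self E_self; force))

lemma commutes_blocks:
  "block_commutes x k \<Longrightarrow> commutes x (K k)" "block_anticommutes x k \<Longrightarrow> anticommutes x (K k)"
  "block_commutes x k \<Longrightarrow> block_commutes x (k-1) \<Longrightarrow> commutes x (A k)"
  "block_commutes x k \<Longrightarrow> block_anticommutes x (k-1) \<Longrightarrow> anticommutes x (A k)"
  "block_anticommutes x k \<Longrightarrow> block_commutes x (k-1) \<Longrightarrow> anticommutes x (A k)"
  "block_anticommutes x k \<Longrightarrow> block_anticommutes x (k-1) \<Longrightarrow> commutes x (A k)"
  "block_commutes x (k-1) \<Longrightarrow> block_commutes x (k+1) \<Longrightarrow> commutes x (C k)"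
  "block_commutes x (k-1) \<Longrightarrow> block_anticommutes x (k+1) \<Longrightarrow> anticommutes x (C k)"
  "block_anticommutes x (k-1) \<Longrightarrow> block_commutes x (k+1) \<Longrightarrow> anticommutes x (C k)"
  "block_anticommutes x (k-1) \<Longrightarrow> block_anticommutes x (k+1) \<Longrightarrow> commutes x (C k)"
  unfolding block_commutes_def block_anticommutes_def blockK_def blockA_def blockC_def right_diff_distrib distrib_left
  by (auto intro!: sign_rules(5,6)) (auto intro: sign_rules(1-4) simp: algebra_simps)

lemma K_anticommutator: "K n * K (n-1) + K (n-1) * K n = 2 * A n"
proof -
  have "anticommutes (E n) (E (n-1))" "anticommutes (E n) (c (2*n-3))" "commutes (E n) (c (2*n-2))"
    "commutes (c (2*n-1)) (E (n-1))" "anticommutes (c (2*n-1)) (c (2*n-3))" "anticommutes (c (2*n-1)) (c (2*n-2))"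
    "anticommutes (c (2*n)) (E (n-1))" "anticommutes (c (2*n)) (c (2*n-3))" "anticommutes (c (2*n)) (c (2*n-2))"
    by (rule gens; force)+
  then show ?thesis
    by (simp add: blockK_def blockA_def commutes_def anticommutes_def algebra_simps mult_2)
qed

lemma K_commutator: "K n * K (n-2) = K (n-2) * K n - 2 * C (n-1)"
proof -
  have "commutes (E n) (E (n-2))" "commutes (E n) (c (2*n-5))" "commutes (E n) (c (2*n-4))"
    "commutes (c (2*n-1)) (E (n-2))" "commutes (c (2*n-1)) (c (2*n-5))" "anticommutes (c (2*n-1)) (c (2*n-4))"
    "commutes (c (2*n)) (E (n-2))" "commutes (c (2*n)) (c (2*n-5))" "commutes (c (2*n)) (c (2*n-4))"
    by (rule gens; force)+
  then show ?thesis
    by (simp add: blockK_def blockC_def commutes_def anticommutes_def algebra_simps mult_2)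
qed

text \<open>The three members of a block anticommute pairwise, so the mixed terms cancel and a sum
  of central squares remains.\<close>

lemma K_sq: "commutes (K n * K n) x"
proof -
  have "anticommutes (E n) (c (2*n-1))" "anticommutes (E n) (c (2*n))" "anticommutes (c (2*n-1)) (c (2*n))"
    by (rule gens; force)+
  then have "K n * K n = E n * E n + c (2*n-1) * c (2*n-1) + c (2*n) * c (2*n)"
    by (simp add: blockK_def anticommutes_def algebra_simps)
  then show ?thesis by (simp add: sign_rules_left E_sq c_sq)
qed

lemma block_neg: "n < 0 \<Longrightarrow> K n = 0" "n < 0 \<Longrightarrow> A n = 0" "n < 1 \<Longrightarrow> C n = 0"
  by (simp_all add: blockK_def blockA_def blockC_def E_neg c_neg)

end

section \<open>Generating function of the charges and its brackets with the block sums\<close>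

locale block_charge = ffd_blocks E c for E c :: "int \<Rightarrow> 'a::ring_1" +
  fixes z :: 'a and q :: "int \<Rightarrow> 'a"
  assumes z_central: "x * z = z * x"
    and q_rec: "q n = q (n-1) + z * (K n * q (n-2) + z * (A n * q (n-3)) + z * (C (n-1) * q (n-4)))"
    and q_neg: "n < 0 \<Longrightarrow> q n = 1"
begin

definition X :: "int \<Rightarrow> 'a" where
  "X n = K n * q (n-2) + z * (A n * q (n-3)) + z * (C (n-1) * q (n-4))"

lemma q_X: "q n = q (n-1) + z * X n"
  unfolding X_def by (rule q_rec)

lemma X_neg: "n < 0 \<Longrightarrow> X n = 0"
  by (simp add: X_def block_neg)

lemma z_commutes: "commutes x z" by (simp add: commutes_def z_central)

lemma q_commutes:
  assumes "\<And>k. k \<le> n \<Longrightarrow> block_commutes x k"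
  shows "commutes x (q n)"
  using assms
proof (induction "nat (n+1)" arbitrary: n rule: less_induct)
  case less
  show ?case
  proof (cases "n < 0")
    case True
    then show ?thesis by (simp add: q_neg commutes_def)
  next
    case False
    then have q: "commutes x (q (n-1))" "commutes x (q (n-2))" "commutes x (q (n-3))" "commutes x (q (n-4))"
      using less by simp_all
    have "commutes x (K n)" "commutes x (A n)" "commutes x (C (n-1))"
      by (rule commutes_blocks; use less.prems in simp)+
    then have "commutes x (X n)"
      unfolding X_def by (intro sign_rules(1,5) z_commutes q)
    then show ?thesis
      unfolding q_X[of n] by (intro sign_rules(1,5) z_commutes q)
  qed
qed

text \<open>\<open>K n\<close>, \<open>A n\<close> and \<open>C (n-1)\<close> each carry exactly one
  factor from block \<open>n\<close>; everything else in \<open>X n\<close> comes from earlier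
  blocks.\<close>

lemma X_anticommutes:
  assumes "\<And>k. k < n \<Longrightarrow> block_commutes x k" "block_anticommutes x n"
  shows "anticommutes x (X n)"
proof -
  have q: "commutes x (q (n-2))" "commutes x (q (n-3))" "commutes x (q (n-4))"
    by (rule q_commutes; use assms in simp)+
  have "anticommutes x (K n)" "anticommutes x (A n)" "anticommutes x (C (n-1))"
    by (rule commutes_blocks; use assms in simp)+
  then show ?thesis
    unfolding X_def
    by (intro sign_rules(6) sign_rules(2) [OF z_commutes] sign_rules(3) [OF _ q(1)]
      sign_rules(3) [OF _ q(2)] sign_rules(3) [OF _ q(3)])
qed

lemma K_q: "k \<le> n - 3 \<Longrightarrow> commutes (K n) (q k)" by (rule q_commutes) (simp add: K_block_commutes)
lemma A_q: "k \<le> n - 3 \<Longrightarrow> commutes (A n) (q k)" by (rule q_commutes) (simp add: A_block_commutes)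
lemma C_q: "k \<le> n - 3 \<Longrightarrow> commutes (C n) (q k)" by (rule q_commutes) (simp add: C_block_commutes)
lemma A_X: "anticommutes (A n) (X (n-2))" by (rule X_anticommutes) (simp_all add: A_block_commutes A_block_anticommutes)
lemma C_X: "anticommutes (C n) (X (n-2))" by (rule X_anticommutes) (simp_all add: C_block_commutes C_block_anticommutes)

lemma z_left: "NO_MATCH z x \<Longrightarrow> x * z = z * x" "NO_MATCH z x \<Longrightarrow> x * (z * y) = z * (x * y)"
  by (simp_all add: z_central mult.assoc [symmetric])

text \<open>\<open>K n\<close> anticommutes with \<open>A (n-1)\<close> and \<open>C (n-2)\<close>
  and commutes with the \<open>q\<close> occurring in \<open>X (n-1)\<close>, so only the
  anticommutator of \<open>K n\<close> and \<open>K (n-1)\<close> contributes. \<open>K_X2\<close>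
  is the analogue for the commutator two blocks away.\<close>

lemma K_X1: "K n * X (n-1) = 2 * (A n * q (n-3)) - X (n-1) * K n"
proof -
  have s: "commutes (K n) (q (n-3))" "commutes (K n) (q (n-4))" "commutes (K n) (q (n-5))"
    by (rule K_q; simp)+
  have a: "anticommutes (K n) (A (n-1))" "anticommutes (K n) (C (n-2))"
    by (rule anticommutes_sym, rule commutes_blocks, simp add: A_block_anticommutes C_block_anticommutes)+
  have k: "K n * (K (n-1) * w) = 2 * (A n * w) - K (n-1) * (K n * w)" for w
    using arg_cong [OF K_anticommutator[of n], of "\<lambda>y. y * w"]
    by (simp add: distrib_right mult.assoc eq_diff_eq)
  show ?thesis
    unfolding X_def
    by (simp add: algebra_simps k anticommutesD[OF a(1)] anticommutesD[OF a(2)] commutesD[OF s(1)] commutesD[OF s(2)] commutesD[OF s(3)] z_left)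
qed

lemma K_X2: "K n * X (n-2) = X (n-2) * K n - 2 * (C (n-1) * q (n-4))"
proof -
  have s: "commutes (K n) (q (n-4))" "commutes (K n) (q (n-5))" "commutes (K n) (q (n-6))"
    by (rule K_q; simp)+
  have a: "commutes (K n) (A (n-2))" "commutes (K n) (C (n-3))"
    by (rule commutes_sym, rule commutes_blocks, simp add: A_block_commutes C_block_commutes)+
  have k: "K n * (K (n-2) * w) = K (n-2) * (K n * w) - 2 * (C (n-1) * w)" for w
    using arg_cong [OF K_commutator[of n], of "\<lambda>y. y * w"]
    by (simp add: left_diff_distrib mult.assoc)
  show ?thesis
    unfolding X_def
    by (simp add: algebra_simps k commutesD[OF a(1)] commutesD[OF a(2)] commutesD[OF s(1)] commutesD[OF s(2)] commutesD[OF s(3)] z_left)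
qed

lemma K_q2: "K n * q (n-2) = q (n-2) * K n - z * (2 * (C (n-1) * q (n-4)))"
proof -
  have "commutes (K n) (q (n-3))" by (simp add: K_q)
  then show ?thesis
    using q_X [of "n-2"] K_X2 [of n]
    by (simp add: commutes_def z_left distrib_left distrib_right right_diff_distrib mult.assoc)
qed

text \<open>This makes \<open>X n\<close> linear in \<open>q (n-1)\<close>. It is written as a sum
  so that no division by 2 occurs.\<close>

lemma X_K: "X n + X n = anticommutator (K n) (q (n-1))"
proof -
  have "K n * q (n-1) = K n * q (n-2) + z * (2 * (A n * q (n-3)) - X (n-1) * K n)"
    using q_X [of "n-1"] K_X1 [of n] by (simp add: distrib_left z_left)
  moreover have "q (n-1) * K n = q (n-2) * K n + z * (X (n-1) * K n)"
    using q_X [of "n-1"] by (simp add: distrib_right mult.assoc)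
  moreover have "q (n-2) * K n = K n * q (n-2) + z * (2 * (C (n-1) * q (n-4)))"
    using K_q2 [of n] by simp
  ultimately show ?thesis
    unfolding X_def by (simp add: algebra_simps mult_2 mult_2_right)
qed

end

section \<open>Symmetric identities for two central parameters\<close>

locale block_charge_pair = p: block_charge E c u q + p': block_charge E c v q'
  for E c :: "int \<Rightarrow> 'a::ring_1" and u v q q' +
  assumes two_cancel: "x + x = 0 \<Longrightarrow> x = 0"
    and uv_cancel: "(u + v) * x = 0 \<Longrightarrow> x = 0"
begin

abbreviation "K \<equiv> blockK E c"
abbreviation "A \<equiv> blockA E c"
abbreviation "C \<equiv> blockC c"
abbreviation "X \<equiv> p.X"
abbreviation "X' \<equiv> p'.X"

text \<open>Rewrite rules for a normal form with the central factors in front, \<open>u\<close>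
  before \<open>v\<close>; the \<open>NO_MATCH\<close> guards prevent looping.\<close>

lemma central_left:
  "NO_MATCH u x \<Longrightarrow> x * u = u * x" "NO_MATCH u x \<Longrightarrow> x * (u * y) = u * (x * y)"
  "NO_MATCH u x \<Longrightarrow> NO_MATCH v x \<Longrightarrow> x * v = v * x"
  "NO_MATCH u x \<Longrightarrow> NO_MATCH v x \<Longrightarrow> x * (v * y) = v * (x * y)"
  by (rule p.z_left p'.z_left; assumption)+

lemmas central_simps = algebra_simps central_left mult_2 mult_2_right

lemma double: "anticommutator x y + anticommutator x y = anticommutator (x + x) y" "commutator x y + commutator x y = commutator (x + x) y" for x y :: 'a
  by (simp_all add: algebra_simps)

lemma two_eq: "x + x = y + y \<Longrightarrow> x = y" for x y :: 'a
  using two_cancel [of "x - y"] by (simp add: algebra_simps)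

definition charges_comm :: "int \<Rightarrow> bool" where "charges_comm n \<longleftrightarrow> commutes (q n) (q' n)"
text \<open>In the commutator of \<open>q n = q (n-1) + u * X n\<close> with
  \<open>q' n = q' (n-1) + v * X' n\<close>, the terms linear in \<open>X n\<close> and
  \<open>X' n\<close> cancel exactly under this condition.\<close>

definition balanced :: "int \<Rightarrow> bool" where
  "balanced n \<longleftrightarrow> u * commutator (X n) (q' (n-1)) = v * commutator (X' n) (q (n-1))"

text \<open>By \<open>X_K\<close> both sides are, up to a factor 2, nested anticommutators of
  \<open>K n\<close> with \<open>q (n-1)\<close> and \<open>q' (n-1)\<close>; these two may be
  exchanged because they commute.\<close>

lemma X_swap:
  assumes "charges_comm (n-1)"
  shows "anticommutator (X n) (q' (n-1)) = anticommutator (X' n) (q (n-1))"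
proof -
  have d: "commutes (q' (n-1)) (q (n-1))" using assms commutes_sym by (simp add: charges_comm_def)
  have "anticommutator (X n + X n) (q' (n-1)) = anticommutator (X' n + X' n) (q (n-1))"
    unfolding p.X_K p'.X_K by (simp add: central_simps commutesD [OF d])
  then show ?thesis
    by - (rule two_eq, simp only: double)
qed

text \<open>The Jacobi identity for \<open>K (n+1)\<close>, \<open>q (n-1)\<close> and \<open>q' (n-1)\<close>.\<close>

lemma C_balanced:
  assumes "charges_comm (n-1)"
  shows "u * commutator (C n * q (n-3)) (q' (n-1)) = v * commutator (C n * q' (n-3)) (q (n-1))"
proof -
  have d: "commutes (q' (n-1)) (q (n-1))" using assms commutes_sym by (simp add: charges_comm_def)
  define x x' where "x = u * (C n * q (n-3))" and "x' = v * (C n * q' (n-3))"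
  have x: "x + x = commutator (q (n-1)) (K (n+1))" "x' + x' = commutator (q' (n-1)) (K (n+1))"
    using p.K_q2 [of "n+1"] p'.K_q2 [of "n+1"]
    by (simp_all add: x_def x'_def mult_2 distrib_left)
  have "commutator (x + x) (q' (n-1)) = commutator (x' + x') (q (n-1))"
    unfolding x by (simp add: central_simps commutesD [OF d])
  then have "commutator x (q' (n-1)) = commutator x' (q (n-1))"
    by - (rule two_eq, simp only: double)
  moreover have "u * commutator (C n * q (n-3)) (q' (n-1)) = commutator x (q' (n-1))"
      "v * commutator (C n * q' (n-3)) (q (n-1)) = commutator x' (q (n-1))"
    by (simp_all add: x_def x'_def central_simps)
  ultimately show ?thesis by simp
qed

text \<open>Pulling \<open>P\<close> to the left past \<open>X n\<close> costs a sign and so turns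
  anticommutators into commutators and vice versa. The first claim thereby reduces to
  \<open>balanced n\<close>, the second to \<open>X_swap\<close>.\<close>

lemma mult_balanced:
  assumes n: "charges_comm (n-1)" "balanced n" and P: "commutes P (q (n-1))" "commutes P (q' (n-1))" "anticommutes P (X n)" "anticommutes P (X' n)"
  shows "anticommutator (P * q (n-1)) (q' n) = anticommutator (P * q' (n-1)) (q n)"
    and "u * commutator (P * q (n-1)) (q' n) = v * commutator (P * q' (n-1)) (q n)"
proof -
  have d: "commutes (q' (n-1)) (q (n-1))" using n commutes_sym by (simp add: charges_comm_def)
  note r = commutesD [OF P(1) [THEN commutes_sym]] commutesD [OF P(2) [THEN commutes_sym]]
    anticommutesD [OF P(3) [THEN anticommutes_sym]] anticommutesD [OF P(4) [THEN anticommutes_sym]] commutesD [OF d]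
  have "anticommutator (P * q (n-1)) (q' n) - anticommutator (P * q' (n-1)) (q n)
    = P * (u * commutator (X n) (q' (n-1)) - v * commutator (X' n) (q (n-1)))"
    unfolding p.q_X [of n] p'.q_X [of n] by (simp add: central_simps r)
  then show "anticommutator (P * q (n-1)) (q' n) = anticommutator (P * q' (n-1)) (q n)"
    using n(2) by (simp add: balanced_def)
  have "u * commutator (P * q (n-1)) (q' n) - v * commutator (P * q' (n-1)) (q n)
    = u * v * P * (anticommutator (X' n) (q (n-1)) - anticommutator (X n) (q' (n-1)))"
    unfolding p.q_X [of n] p'.q_X [of n] by (simp add: central_simps r)
  then show "u * commutator (P * q (n-1)) (q' n) = v * commutator (P * q' (n-1)) (q n)"
    using X_swap [OF n(1)] by simp
qed

lemma A_balanced: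
  assumes "charges_comm (m-3)" "balanced (m-2)"
  shows "anticommutator (A m * q (m-3)) (q' (m-2)) = anticommutator (A m * q' (m-3)) (q (m-2))"
    and "u * commutator (A m * q (m-3)) (q' (m-2)) = v * commutator (A m * q' (m-3)) (q (m-2))"
  using mult_balanced [of "m-2" "A m"] assms by (simp_all add: p.A_q p'.A_q p.A_X p'.A_X)

section \<open>The obstruction and its recursion\<close>

definition F :: "int \<Rightarrow> 'a" where
  "F n = anticommutator (C n * q (n-3)) (q' (n-1)) - anticommutator (C n * q' (n-3)) (q (n-1))"
definition G :: "int \<Rightarrow> 'a" where
  "G n = u * u * anticommutator (C n * q (n-3)) (q' (n-1)) - v * v * anticommutator (C n * q' (n-3)) (q (n-1))"
text \<open>The inhomogeneous term common to the recursions of \<open>F\<close> and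
  \<open>G\<close>. Its commutators carry the weights \<open>v\<close> and \<open>u\<close> in the
  order opposite to \<open>balanced\<close>, so they do not cancel.\<close>

definition \<Psi> :: "int \<Rightarrow> 'a" where
  "\<Psi> n = 2 * (v * v - u * u) * (q n * q' n)
    - u * v * (v * commutator (X (n+1)) (q' n) - u * commutator (X' (n+1)) (q n))"

text \<open>Each summand has a definite sign when moved past \<open>C (n+1)\<close>: minus for \<open>X (n-1)\<close> and \<open>y n\<close>, plus for the others.\<close>

lemma q_split:
  defines "y n \<equiv> K n * q (n-2) + u * (C (n-1) * q (n-4))"
  shows "q n = q (n-2) + u * X (n-1) + u * (y n + u * (A n * q (n-3)))"
  using p.q_X [of n] p.q_X [of "n-1"] by (simp add: y_def p.X_def algebra_simps)

lemma q'_split: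
  defines "y n \<equiv> K n * q' (n-2) + v * (C (n-1) * q' (n-4))"
  shows "q' n = q' (n-2) + v * X' (n-1) + v * (y n + v * (A n * q' (n-3)))"
  using p'.q_X [of n] p'.q_X [of "n-1"] by (simp add: y_def p'.X_def algebra_simps)

text \<open>Moving \<open>q' (n-2)\<close> past \<open>K n\<close> produces twice the product
  \<open>C (n-1) * q' (n-4)\<close> by \<open>K_q2\<close>; \<open>C_balanced\<close> rewrites the
  remaining commutator in the same terms, and the two combine to an anticommutator.\<close>

lemma split_commutator:
  assumes "charges_comm (n-2)"
  shows "commutator (K n * q (n-2) + u * (C (n-1) * q (n-4))) (q' (n-2))
      = - (v * anticommutator (C (n-1) * q' (n-4)) (q (n-2)))"
    and "commutator (K n * q' (n-2) + v * (C (n-1) * q' (n-4))) (q (n-2))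
      = - (u * anticommutator (C (n-1) * q (n-4)) (q' (n-2)))"
proof -
  have d: "commutes (q' (n-2)) (q (n-2))" using assms commutes_sym by (simp add: charges_comm_def)
  define x x' where "x = C (n-1) * q (n-4)" and "x' = C (n-1) * q' (n-4)"
  have k: "q (n-2) * K n = K n * q (n-2) + u * (x + x)" "q' (n-2) * K n = K n * q' (n-2) + v * (x' + x')"
    using p.K_q2 [of n] p'.K_q2 [of n] by (simp_all add: x_def x'_def algebra_simps mult_2)
  then have k2: "q (n-2) * (K n * w) = K n * (q (n-2) * w) + u * (x + x) * w"
      "q' (n-2) * (K n * w) = K n * (q' (n-2) * w) + v * (x' + x') * w" for w
    by (simp_all add: distrib_right mult.assoc [symmetric])
  have good: "u * commutator x (q' (n-2)) = v * commutator x' (q (n-2))"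
    using C_balanced [of "n-1"] assms by (simp add: x_def x'_def)
  have "commutator (K n * q (n-2) + u * x) (q' (n-2)) + v * anticommutator x' (q (n-2))
     = u * commutator x (q' (n-2)) - v * commutator x' (q (n-2))"
    by (simp add: central_simps k2 commutesD [OF d])
  then show "commutator (K n * q (n-2) + u * (C (n-1) * q (n-4))) (q' (n-2))
      = - (v * anticommutator (C (n-1) * q' (n-4)) (q (n-2)))"
    using good by (simp add: x_def x'_def eq_neg_iff_add_eq_0)
  have "commutator (K n * q' (n-2) + v * x') (q (n-2)) + u * anticommutator x (q' (n-2))
     = v * commutator x' (q (n-2)) - u * commutator x (q' (n-2))"
    by (simp add: central_simps k2 commutesD [OF d])
  then show "commutator (K n * q' (n-2) + v * (C (n-1) * q' (n-4))) (q (n-2))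
      = - (u * anticommutator (C (n-1) * q (n-4)) (q' (n-2)))"
    using good by (simp add: x_def x'_def eq_neg_iff_add_eq_0)
qed

text \<open>\<open>C n\<close> is factored out of the split forms of \<open>q (n-1)\<close> and
  \<open>q' (n-1)\<close>. Summands that anticommute with \<open>C n\<close> then appear in
  commutators, those that commute with it in anticommutators.\<close>

lemma FG_rec:
  assumes D3: "charges_comm (n-3)" and D4: "charges_comm (n-4)" and J2: "balanced (n-2)" and J3: "balanced (n-3)"
  shows "F n = C n * (u * v * F (n-2) + A (n-1) * \<Psi> (n-4))"
    and "G n = C n * (u * v * G (n-2) - \<Psi> (n-3))"
proof -
  define t t' W W' where "t = q (n-3)" and "t' = q' (n-3)" and "W = X (n-2)" and "W' = X' (n-2)"
  define w w' V V' where "w = q (n-4)" and "w' = q' (n-4)" and "V = X (n-3)" and "V' = X' (n-3)"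
  define y y' where "y = K (n-1) * t + u * (C (n-2) * q (n-5))"
    and "y' = K (n-1) * t' + v * (C (n-2) * q' (n-5))"
  define h h' where "h = A (n-1) * w" and "h' = A (n-1) * w'"
  note defs = t_def t'_def W_def W'_def w_def w'_def V_def V'_def y_def y'_def h_def h'_def
  have r: "q (n-1) = t + u * W + u * (y + u * h)" "q' (n-1) = t' + v * W' + v * (y' + v * h')"
    using q_split [of "n-1"] q'_split [of "n-1"] by (simp_all add: defs)
  have cK: "anticommutes (C n) (K (n-1))" "anticommutes (C n) (C (n-2))" "commutes (C n) (A (n-1))"
    by (rule p.commutes_blocks; simp add: p.C_block_anticommutes p.C_block_commutes)+
  have "commutes (C n) t" "commutes (C n) t'" "anticommutes (C n) W" "anticommutes (C n) W'"
    by (simp_all add: defs p.C_q p'.C_q p.C_X p'.C_X)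
  note c1 = this(1,2) [THEN commutes_sym] this(3,4) [THEN anticommutes_sym]
  have q5: "commutes (C n) (q (n-5))" "commutes (C n) (q' (n-5))" "commutes (C n) w" "commutes (C n) w'" "commutes (C n) t" "commutes (C n) t'"
    by (simp_all add: p.C_q p'.C_q defs)
  have c2: "anticommutes y (C n)" "anticommutes y' (C n)" "commutes h (C n)" "commutes h' (C n)"
    unfolding y_def y'_def h_def h'_def
    by (rule anticommutes_sym, intro sign_rules(6) sign_rules(3) [OF cK(1)] sign_rules(3) [OF cK(2)]
         sign_rules(2) [OF p.z_commutes] sign_rules(2) [OF p'.z_commutes] q5)+
       (rule commutes_sym, intro sign_rules(1) [OF cK(3)] q5)+
  note cr = c1(1,2) [THEN commutesD(1)] c1(1,2) [THEN commutesD(2)] c1(3,4) [THEN anticommutesD(1)] c1(3,4) [THEN anticommutesD(2)]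
    c2(3,4) [THEN commutesD(1)] c2(3,4) [THEN commutesD(2)] c2(1,2) [THEN anticommutesD(1)] c2(1,2) [THEN anticommutesD(2)]
  have d: "commutes t' t" "commutes w' w" using D3 D4 commutes_sym by (simp_all add: charges_comm_def defs)
  have J2': "u * commutator W t' = v * commutator W' t" using J2 by (simp add: balanced_def defs)
  have J3': "u * commutator V w' = v * commutator V' w" using J3 by (simp add: balanced_def defs)
  have hg: "anticommutator h t' = anticommutator h' t"
    using A_balanced(1) [of "n-1"] D4 J3 by (simp add: defs)
  have yc: "commutator y t' = - (v * anticommutator (C (n-2) * q' (n-5)) t)" "commutator y' t = - (u * anticommutator (C (n-2) * q (n-5)) t')"
    using split_commutator [of "n-1"] D3 by (simp_all add: defs)
  have tV: "t = w + u * V" "t' = w' + v * V'"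
    using p.q_X [of "n-3"] p'.q_X [of "n-3"] by (simp_all add: defs)
  have "commutes (A (n-1)) w" "commutes (A (n-1)) w'" "anticommutes (A (n-1)) V" "anticommutes (A (n-1)) V'"
    using p.A_X [of "n-1"] p'.A_X [of "n-1"] by (simp_all add: defs p.A_q p'.A_q)
  note a = this(1,2) [THEN commutes_sym] this(3,4) [THEN anticommutes_sym]
  note ar = a(1,2) [THEN commutesD(1)] a(1,2) [THEN commutesD(2)] a(3,4) [THEN anticommutesD(1)] a(3,4) [THEN anticommutesD(2)]
  \<comment> \<open>One more step of the recursion, \<open>t = w + u * V\<close>, is needed here:
    \<open>A (n-1)\<close> commutes with \<open>w\<close> and anticommutes with \<open>V\<close>, so
    it factors out as well.\<close>
  have hPsi: "v * v * anticommutator h' t - u * u * anticommutator h t' = A (n-1) * \<Psi> (n-4)"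
    unfolding \<Psi>_def h_def h'_def tV by (simp add: central_simps ar d[THEN commutesD(1)] d[THEN commutesD(2)] flip: w_def w'_def V_def V'_def)
  have F2: "F (n-2) = anticommutator (C (n-2) * q (n-5)) t' - anticommutator (C (n-2) * q' (n-5)) t"
    by (simp add: F_def defs)
  have G2: "G (n-2) = u * u * anticommutator (C (n-2) * q (n-5)) t' - v * v * anticommutator (C (n-2) * q' (n-5)) t"
    by (simp add: G_def defs)
  have "F n = C n * ((u * commutator W t' - v * commutator W' t) + (u * commutator y t' - v * commutator y' t) + (v * v * anticommutator h' t - u * u * anticommutator h t'))"
    unfolding F_def r by (simp add: central_simps cr d[THEN commutesD(1)] d[THEN commutesD(2)] flip: t_def t'_def)
  then show "F n = C n * (u * v * F (n-2) + A (n-1) * \<Psi> (n-4))"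
    unfolding J2' hPsi yc F2 by (simp add: central_simps)
  have "G n = C n * ((u * v * (v * commutator W t' - u * commutator W' t) - 2 * (v * v - u * u) * (t * t'))
      + u * v * (v * commutator y t' - u * commutator y' t) + u * u * v * v * (anticommutator h' t - anticommutator h t'))"
    unfolding G_def r by (simp add: central_simps cr d[THEN commutesD(1)] d[THEN commutesD(2)] flip: t_def t'_def)
  moreover have "v * commutator y t' - u * commutator y' t = G (n-2)"
    unfolding yc G2 by (simp add: central_simps)
  moreover have "u * v * (v * commutator W t' - u * commutator W' t) - 2 * (v * v - u * u) * (t * t') = - \<Psi> (n-3)"
    by (simp add: \<Psi>_def defs)
  ultimately show "G n = C n * (u * v * G (n-2) - \<Psi> (n-3))"
    by (simp add: hg)
qed

lemma F_plus_A_G: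
  assumes "\<And>m. m < n \<Longrightarrow> charges_comm m" "\<And>m. m < n \<Longrightarrow> balanced m"
  shows "F n + A (n+1) * G (n-1) = 0"
  using assms
proof (induction "nat n" arbitrary: n rule: less_induct)
  case less
  show ?case
  proof (cases "n < 1")
    case True
    then show ?thesis by (simp add: F_def G_def p.block_neg)
  next
    case False
    \<comment> \<open>The hypothesis on \<open>A\<close> and \<open>C\<close> enters here. These two
      commutations bring it into a form that moves \<open>C n\<close> to the front of both
      summands.\<close>
    have "commutes (A (n+1)) (C (n-1))" "commutes (C n) (A (n-1))"
      by (rule p.commutes_blocks; simp add: p.A_block_commutes p.C_block_anticommutes)+
    then have "A (n+1) * C (n-1) = C n * A (n-1)"
      using p.AC [of "n-1"] by (simp add: commutes_def add.commute)
    then have AC: "A (n+1) * (C (n-1) * w) = C n * (A (n-1) * w)" for w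
      by (simp add: mult.assoc [symmetric])
    have IH: "F (n-2) + A (n-1) * G (n-3) = 0"
      using less.hyps [of "n-2"] less.prems False by simp
    \<comment> \<open>The index shift between \<open>F n\<close> and \<open>G (n-1)\<close> makes
      both inhomogeneous terms \<open>\<Psi> (n-4)\<close>; they cancel, and a multiple of the same
      expression at \<open>n-2\<close> remains.\<close>
    have "F n = C n * (u * v * F (n-2) + A (n-1) * \<Psi> (n-4))"
      "G (n-1) = C (n-1) * (u * v * G (n-3) - \<Psi> (n-4))"
      using FG_rec(1) [of n] FG_rec(2) [of "n-1"] less.prems by simp_all
    then have "F n + A (n+1) * G (n-1) = C n * (u * v * F (n-2) + A (n-1) * \<Psi> (n-4))
        + C n * (A (n-1) * (u * v * G (n-3) - \<Psi> (n-4)))"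
      by (simp only: AC)
    also have "\<dots> = u * v * C n * (F (n-2) + A (n-1) * G (n-3))"
      by (simp add: central_simps)
    finally have "F n + A (n+1) * G (n-1) = u * v * C n * (F (n-2) + A (n-1) * G (n-3))" .
    then show ?thesis by (simp add: IH)
  qed
qed

section \<open>Induction on the number of blocks\<close>

lemma balanced_step:
  assumes charges_comm: "\<And>m. m \<le> n \<Longrightarrow> charges_comm m" and balanced: "\<And>m. m \<le> n \<Longrightarrow> balanced m"
  shows "balanced (n+1)"
proof -
  define t t' x x' where "t = q (n-1)" and "t' = q' (n-1)" and "x = X n" and "x' = X' n"
  define r r' s s' Z Z' where "r = q (n-2)" and "r' = q' (n-2)" and "s = q (n-3)" and "s' = q' (n-3)"
    and "Z = X (n-2)" and "Z' = X' (n-2)"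
  define P L where "P = A (n+1)" and "L = K (n+1)"
  define a a' c0 c0' e e' where "a = P * r" and "a' = P * r'"
    and "c0 = C n * s" and "c0' = C n * s'" and "e = a + c0" and "e' = a' + c0'"
  define h h' g g' where "h = A n * s" and "h' = A n * s'"
    and "g = C (n-1) * q (n-4)" and "g' = C (n-1) * q' (n-4)"
  note defs = t_def t'_def x_def x'_def r_def r'_def s_def s'_def Z_def Z'_def
  note defs2 = P_def L_def a_def a'_def c0_def c0'_def h_def h'_def g_def g'_def
  have dt: "commutes t' t" "commutes r' r" "commutes s' s"
    using charges_comm [of "n-1"] charges_comm [of "n-2"] charges_comm [of "n-3"] by (simp_all add: charges_comm_def commutes_def defs)
  note d = dt [THEN commutesD(1)] dt [THEN commutesD(2)]
  have q: "q n = t + u * x" "q' n = t' + v * x'" "r = s + u * Z" "r' = s' + v * Z'"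
    using p.q_X [of n] p'.q_X [of n] p.q_X [of "n-2"] p'.q_X [of "n-2"] by (simp_all add: defs)
  have x: "x = K n * r + u * g + u * h" "x' = K n * r' + v * g' + v * h'"
    by (simp_all add: defs defs2 p.X_def p'.X_def)
  have X1: "X (n+1) = L * t + u * e" "X' (n+1) = L * t' + v * e'"
    by (simp_all add: defs defs2 e_def e'_def p.X_def p'.X_def algebra_simps)
  have cL: "t * L = L * t + u * (c0 + c0)" "t' * L = L * t' + v * (c0' + c0')"
    "x * L = a + a - L * x" "x' * L = a' + a' - L * x'"
    using p.K_q2 [of "n+1"] p'.K_q2 [of "n+1"] p.K_X1 [of "n+1"] p'.K_X1 [of "n+1"]
    by (simp_all add: defs defs2 algebra_simps mult_2)
  have cL2: "t * (L * w) = L * (t * w) + u * (c0 + c0) * w"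
    "t' * (L * w) = L * (t' * w) + v * (c0' + c0') * w"
    "x * (L * w) = (a + a) * w - L * (x * w)"
    "x' * (L * w) = (a' + a') * w - L * (x' * w)" for w
    using cL [THEN arg_cong, of "\<lambda>y. y * w"]
    by (simp_all add: distrib_right left_diff_distrib mult.assoc)
  have sym: "anticommutator x t' = anticommutator x' t" "anticommutator Z s' = anticommutator Z' s"
    using X_swap [of n] X_swap [of "n-2"] charges_comm by (simp_all add: defs)
  have agood: "anticommutator a t' = anticommutator a' t" "u * commutator a t' = v * commutator a' t"
    using A_balanced [of "n+1"] charges_comm balanced by (simp_all add: defs defs2)
  have hgood: "anticommutator h r' = anticommutator h' r"
    using A_balanced(1) [of n] charges_comm balanced by (simp add: defs defs2)
  have cgood: "u * commutator c0 t' = v * commutator c0' t" "u * commutator g r' = v * commutator g' r"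
    using C_balanced [of n] C_balanced [of "n-1"] charges_comm by (simp_all add: defs defs2)
  have ggood: "anticommutator g s' = anticommutator g' s"
    using mult_balanced(1) [of "n-3" "C (n-1)"] charges_comm balanced p.C_X [of "n-1"] p'.C_X [of "n-1"]
    by (simp add: p.C_q p'.C_q defs defs2)

  have "anticommutes (C n) (A n)" "anticommutes (C n) (C (n-1))"
    by (rule p.commutes_blocks; simp add: p.C_block_commutes p.C_block_anticommutes)+
  note Cn = p.C_q p'.C_q p.C_X p'.C_X p.commutes_blocks(1) [OF p.C_block_commutes]
    sign_rules(3) [OF this(1)] sign_rules(3) [OF this(2)]
  have "commutes (C n) s" "commutes (C n) s'" "commutes (C n) (K n)"
    "anticommutes (C n) Z" "anticommutes (C n) Z'" "anticommutes (C n) h" "anticommutes (C n) h'" "anticommutes (C n) g" "anticommutes (C n) g'"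
    unfolding defs defs2 by (intro Cn; simp)+
  note C1 = this(1-3) [THEN commutes_sym] this(4-9) [THEN anticommutes_sym]
  note C2 = C1(1-3) [THEN commutesD(1)] C1(1-3) [THEN commutesD(2)] C1(4-9) [THEN anticommutesD(1)] C1(4-9) [THEN anticommutesD(2)]
  have "commutes s (K n)" "commutes s' (K n)" "commutes s (A n)" "commutes s' (A n)"
    unfolding defs by (intro commutes_sym [OF p.K_q] commutes_sym [OF p'.K_q] commutes_sym [OF p.A_q] commutes_sym [OF p'.A_q]; simp)+
  note s2 = this [THEN commutesD(1)] this [THEN commutesD(2)]
  \<comment> \<open>The part of \<open>e\<close> coming from \<open>C n\<close> contributes nothing:
    after factoring out \<open>C n\<close>, only differences that are symmetric by
    \<open>X_swap\<close> and \<open>mult_balanced\<close> remain.\<close>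
  have "u * commutator c0 x' - v * commutator c0' x = u * v * C n * (K n * (anticommutator Z' s - anticommutator Z s') + (anticommutator g' s - anticommutator g s'))"
    unfolding x q(3,4) c0_def c0'_def by (simp add: central_simps C2 s2 d h_def h'_def)
  then have cx: "u * commutator c0 x' = v * commutator c0' x"
    by (simp add: sym ggood)

  have "anticommutes P (A n)" "commutes P (C (n-1))"
    unfolding P_def by (rule p.commutes_blocks; simp add: p.A_block_commutes p.A_block_anticommutes)+
  note An = p.A_q p'.A_q p.commutes_blocks(1) [OF p.A_block_commutes] sign_rules(3) [OF this(1) [unfolded P_def]] sign_rules(1) [OF this(2) [unfolded P_def]]
  have "commutes P r" "commutes P r'" "commutes P (K n)" "commutes P g" "commutes P g'"
     "anticommutes P h" "anticommutes P h'"
    unfolding defs defs2 by (intro An; simp)+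
  note A1 = this(1-5) [THEN commutes_sym] this(6-7) [THEN anticommutes_sym]
  note A2 = A1(1-5) [THEN commutesD(1)] A1(1-5) [THEN commutesD(2)] A1(6-7) [THEN anticommutesD(1)] A1(6-7) [THEN anticommutesD(2)]
  have rK: "r * K n = K n * r + u * (g + g)" "r' * K n = K n * r' + v * (g' + g')"
    using p.K_q2 [of n] p'.K_q2 [of n] by (simp_all add: defs defs2 algebra_simps mult_2)
  have rK2: "r * (K n * w) = K n * (r * w) + u * (g + g) * w"
    "r' * (K n * w) = K n * (r' * w) + v * (g' + g') * w" for w
    using rK [THEN arg_cong, of "\<lambda>y. y * w"] by (simp_all add: distrib_right mult.assoc)
  \<comment> \<open>The part of \<open>e\<close> coming from \<open>A (n+1)\<close> leaves exactly
    \<open>P * G (n-1)\<close>, which \<open>F n\<close> compensates by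
    \<open>F_plus_A_G\<close>.\<close>
  have "u * commutator a x' - v * commutator a' x - P * G (n-1)
    = P * ((u + v) * (u * commutator g r' - v * commutator g' r) + u * v * (anticommutator h' r - anticommutator h r'))"
    unfolding x a_def a'_def G_def by (simp add: central_simps A2 rK rK2 d flip: g_def g'_def r_def r'_def)
  then have ax: "u * commutator a x' - v * commutator a' x = P * G (n-1)"
    by (simp add: cgood hgood)

  have Fe: "anticommutator e t' - anticommutator e' t = F n"
    using agood(1) by (simp add: e_def e'_def F_def algebra_simps flip: t_def t'_def s_def s'_def c0_def c0'_def)
  have "u * commutator e x' - v * commutator e' x = P * G (n-1)"
    using cx ax by (simp add: e_def e'_def algebra_simps)
  moreover have "F n + P * G (n-1) = 0"
    unfolding P_def by (rule F_plus_A_G) (simp_all add: charges_comm balanced)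
  ultimately have FG: "F n + (u * commutator e x' - v * commutator e' x) = 0" by simp
  have egood: "u * commutator e t' - v * commutator e' t = 0"
    using agood(2) cgood(1) by (simp add: e_def e'_def algebra_simps)
  \<comment> \<open>The first group vanishes by \<open>X_swap\<close>, the second by
    \<open>A_balanced\<close> and \<open>C_balanced\<close>, and the third is the
    obstruction.\<close>
  have "u * commutator (X (n+1)) (q' n) - v * commutator (X' (n+1)) (q n)
    = u * v * L * (anticommutator x' t - anticommutator x t') + (u + v) * (u * commutator e t' - v * commutator e' t)
      + u * v * ((anticommutator e t' - anticommutator e' t) + (u * commutator e x' - v * commutator e' x))"
    unfolding q X1 by (simp add: central_simps cL cL2 d e_def e'_def)
  also have "\<dots> = 0"
    unfolding Fe FG egood by (simp add: sym)
  finally show ?thesis by (simp add: balanced_def)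
qed

lemma charges_comm_step:
  assumes "charges_comm (n-1)" "balanced n"
  shows "charges_comm n"
proof -
  define t t' x x' \<kappa> where "t = q (n-1)" and "t' = q' (n-1)" and "x = X n" and "x' = X' n" and "\<kappa> = K n"
  define \<Delta> where "\<Delta> = t * (\<kappa> * t') - t' * (\<kappa> * t)"
  have d: "commutes t' t" using assms commutes_sym by (simp add: charges_comm_def t_def t'_def)
  have x: "x + x = anticommutator \<kappa> t" "x' + x' = anticommutator \<kappa> t'"
    by (simp_all add: t_def t'_def x_def x'_def \<kappa>_def p.X_K p'.X_K)
  have balanced: "u * commutator x t' - v * commutator x' t = 0" using assms by (simp add: balanced_def t_def t'_def x_def x'_def)
  have kk: "w * (\<kappa> * \<kappa>) = \<kappa> * (\<kappa> * w)" "w * (\<kappa> * (\<kappa> * y)) = \<kappa> * (\<kappa> * (w * y))" for w y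
    using p.K_sq [of n w] by (auto simp only: \<kappa>_def commutes_def mult.assoc [symmetric])
  \<comment> \<open>By the balance relation, \<open>(u + v) * \<Delta>\<close> is a central multiple
    of a commutator with \<open>\<kappa>\<close>. Since the square of \<open>\<kappa>\<close> is
    central, every such commutator anticommutes with \<open>\<kappa>\<close>, hence so does
    \<open>\<Delta>\<close>.\<close>
  have "(u + v) * \<Delta> - (v - u) * commutator \<kappa> (t * t') = u * commutator (x + x) t' - v * commutator (x' + x') t"
    unfolding x by (simp add: \<Delta>_def central_simps commutesD [OF d])
  also have "\<dots> = (u * commutator x t' - v * commutator x' t) + (u * commutator x t' - v * commutator x' t)"
    by (simp add: algebra_simps)
  finally have \<Delta>: "(u + v) * \<Delta> - (v - u) * commutator \<kappa> (t * t') = 0"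
    by (simp only: balanced add_0)
  have "(u + v) * anticommutator \<kappa> \<Delta> = anticommutator \<kappa> ((u + v) * \<Delta> - (v - u) * commutator \<kappa> (t * t'))"
    by (simp add: central_simps kk [of t] kk [of t'])
  then have "(u + v) * anticommutator \<kappa> \<Delta> = 0" by (simp only: \<Delta> mult_zero_left mult_zero_right add_0)
  then have ac0: "anticommutator \<kappa> \<Delta> = 0" by (rule uv_cancel)
  \<comment> \<open>Four times the quadratic term of the commutator of \<open>q n\<close> and
    \<open>q' n\<close> is the anticommutator of \<open>\<kappa>\<close> and
    \<open>\<Delta>\<close>.\<close>
  have "(commutator x x' + commutator x x') + (commutator x x' + commutator x x') = commutator (x + x) (x' + x')"
    by (simp add: algebra_simps)
  also have "\<dots> = anticommutator \<kappa> \<Delta>"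
    unfolding x \<Delta>_def by (simp add: central_simps kk [of t] kk [of t'] commutesD [OF d])
  finally have "(commutator x x' + commutator x x') + (commutator x x' + commutator x x') = 0"
    by (simp only: ac0)
  then have xx: "commutator x x' = 0" by (rule two_cancel [OF two_cancel])
  have "commutator (q n) (q' n) = (u * commutator x t' - v * commutator x' t) + u * v * commutator x x'"
    unfolding p.q_X [of n] p'.q_X [of n]
    by (simp add: central_simps commutesD [OF d] flip: t_def t'_def x_def x'_def)
  then show ?thesis
    unfolding balanced xx by (simp add: charges_comm_def commutes_def)
qed

lemma q_commute: "q n * q' n = q' n * q n"
proof -
  have "charges_comm n \<and> balanced n" for n
  proof (induction "nat (n+1)" arbitrary: n rule: less_induct)
    case less
    show ?case
    proof (cases "n < 0")
      case True
      then show ?thesis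
        by (simp add: charges_comm_def balanced_def commutes_def p.q_neg p'.q_neg p.X_neg p'.X_neg)
    next
      case False
      have IH: "charges_comm m \<and> balanced m" if "m < n" for m
        using less.hyps [of m] that False by simp
      then have "balanced n" using balanced_step [of "n-1"] by simp
      then show ?thesis using charges_comm_step IH by simp
    qed
  qed
  then show ?thesis by (simp add: charges_comm_def commutes_def)
qed

end

section \<open>Independence polynomials and coefficient extraction\<close>

lemma prod_list_insort:
  fixes g :: "'b::linorder \<Rightarrow> 'a::monoid_mult"
  assumes "\<And>y. y \<in> set ys \<Longrightarrow> g x * g y = g y * g x"
  shows "prod_list (map g (insort x ys)) = g x * prod_list (map g ys)"
  using assms by (induction ys) (simp_all flip: mult.assoc)

lemma ffd_hS_empty: "ffd_hS g {} = 1"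
  by (simp add: ffd_hS_def)

lemma ffd_hS_insert:
  assumes "finite S" "x \<notin> S" "\<And>y. y \<in> S \<Longrightarrow> g x * g y = g y * g x"
  shows "ffd_hS g (insert x S) = g x * ffd_hS g S"
  using assms prod_list_insort [of "sorted_list_of_set S" g x]
  by (simp add: ffd_hS_def)

lemma finite_ffd_V: "finite (ffd_V M)"
proof -
  have "ffd_V M \<subseteq> {False, True} \<times> {0..2 * int M + 1}"
    unfolding ffd_V_def by auto
  then show ?thesis by (rule finite_subset) simp
qed

lemma not_ffd_adj_refl: "\<not> ffd_adj M x x"
  by (cases x; cases "fst x") (auto simp: ffd_adj_def)

lemma ffd_adj_sym: "ffd_adj M x y \<Longrightarrow> ffd_adj M y x"
  by (auto simp: ffd_adj_def)

text \<open>Independence polynomial of the subgraph induced on \<open>W\<close>. Independent sets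
  lie in \<open>ffd_V M\<close> anyway, so \<open>W\<close> may contain labels outside the graph and
  may be infinite.\<close>

definition indep_poly :: "nat \<Rightarrow> (gen \<Rightarrow> 'a::ring_1) \<Rightarrow> 'a \<Rightarrow> gen set \<Rightarrow> 'a" where
  "indep_poly M g z W = (\<Sum>S | ffd_indep M S \<and> S \<subseteq> W. z ^ card S * ffd_hS g S)"

lemma finite_indep: "finite {S. ffd_indep M S \<and> P S}" "ffd_indep M S \<Longrightarrow> finite S"
  using finite_ffd_V [of M] by (auto simp: ffd_indep_def intro: finite_subset finite_subset [of _ "Pow (ffd_V M)"])

lemma indep_poly_cong:
  "W \<inter> ffd_V M = W' \<inter> ffd_V M \<Longrightarrow> indep_poly M g z W = indep_poly M g z W'"
  unfolding indep_poly_def by (intro sum.cong) (auto simp: ffd_indep_def)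

lemma indep_poly_empty: "W \<inter> ffd_V M = {} \<Longrightarrow> indep_poly M g z W = 1"
proof -
  assume "W \<inter> ffd_V M = {}"
  then have "{S. ffd_indep M S \<and> S \<subseteq> W} = {{}}"
    by (auto simp: ffd_indep_def)
  then show ?thesis by (simp add: indep_poly_def ffd_hS_empty)
qed

text \<open>Deletion recursion: independent sets avoiding \<open>x\<close>, plus those containing
  \<open>x\<close>, which avoid its neighbours.\<close>

lemma indep_poly_remove:
  assumes z: "\<And>y. y * z = z * y"
    and com: "\<And>y. y \<in> ffd_V M \<Longrightarrow> y \<noteq> x \<Longrightarrow> \<not> ffd_adj M x y \<Longrightarrow> g x * g y = g y * g x"
    and x: "x \<in> ffd_V M" "x \<in> W"
  shows "indep_poly M g z W = indep_poly M g z (W - {x})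
    + z * (g x * indep_poly M g z (W - {x} - {y. ffd_adj M x y}))"
proof -
  let ?I = "\<lambda>W. {S. ffd_indep M S \<and> S \<subseteq> W}"
  let ?f = "\<lambda>S. z ^ card S * ffd_hS g S"
  let ?N = "W - {x} - {y. ffd_adj M x y}"
  have "S \<in> insert x ` ?I ?N" if S: "S \<in> ?I W" "x \<in> S" for S
  proof
    show "S = insert x (S - {x})" using S by auto
    show "S - {x} \<in> ?I ?N" using S by (auto simp: ffd_indep_def)
  qed
  moreover have "insert x S \<in> ?I W" if "S \<in> ?I ?N" for S
  proof -
    have "\<not> ffd_adj M u x" "\<not> ffd_adj M x u" if "u \<in> S" for u
      using that \<open>S \<in> ?I ?N\<close> ffd_adj_sym [of M u x] by auto
    then show ?thesis
      using that x not_ffd_adj_refl [of M x] by (auto simp: ffd_indep_def)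
  qed
  ultimately have "?I W = ?I (W - {x}) \<union> insert x ` ?I ?N"
    by blast
  then have "indep_poly M g z W = sum ?f (?I (W - {x}) \<union> insert x ` ?I ?N)"
    by (simp add: indep_poly_def)
  also have "\<dots> = sum ?f (?I (W - {x})) + sum ?f (insert x ` ?I ?N)"
    by (rule sum.union_disjoint) (auto simp: finite_indep)
  also have "sum ?f (insert x ` ?I ?N) = (\<Sum>S\<in>?I ?N. ?f (insert x S))"
    by (rule sum.reindex_cong [OF _ refl refl]) (auto simp: inj_on_def)
  also have "\<dots> = (\<Sum>S\<in>?I ?N. z * (g x * ?f S))"
  proof (rule sum.cong [OF refl])
    fix S assume S: "S \<in> ?I ?N"
    then have "finite S" "x \<notin> S" by (auto simp: finite_indep)
    moreover have "g x * g y = g y * g x" if "y \<in> S" for y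
    proof (rule com)
      show "y \<in> ffd_V M" "y \<noteq> x" "\<not> ffd_adj M x y"
        using that S by (auto simp: ffd_indep_def)
    qed
    moreover have "g x * z ^ k = z ^ k * g x" for k
      by (rule power_commuting_commutes [symmetric]) (simp add: z)
    ultimately show "?f (insert x S) = z * (g x * ?f S)"
      by (simp add: ffd_hS_insert mult.assoc [symmetric])
  qed
  also have "\<dots> = z * (g x * sum ?f (?I ?N))"
    by (simp add: sum_distrib_left)
  finally show ?thesis by (simp add: indep_poly_def)
qed

lemma indep_poly_eq_sum_ffd_Q:
  assumes "card (ffd_V M) \<le> N"
  shows "indep_poly M g z (ffd_V M) = (\<Sum>k\<le>N. z ^ k * ffd_Q M g k)"
proof -
  have "card S \<le> N" if "ffd_indep M S" for S
    using that assms card_mono [OF finite_ffd_V, of S M] by (auto simp: ffd_indep_def)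
  then have "indep_poly M g z (ffd_V M)
      = (\<Sum>k\<le>N. \<Sum>S | S \<in> {S. ffd_indep M S \<and> S \<subseteq> ffd_V M} \<and> card S = k. z ^ card S * ffd_hS g S)"
    unfolding indep_poly_def
    by (intro sum.group [symmetric]) (auto simp: finite_indep)
  also have "\<dots> = (\<Sum>k\<le>N. z ^ k * ffd_Q M g k)"
    unfolding ffd_Q_def sum_distrib_left
    by (intro sum.cong) (auto simp: ffd_indep_def)
  finally show ?thesis .
qed

section \<open>Complex scalars and vanishing of coefficients\<close>

lemma cplx_alg_props:
  assumes "cplx_alg sc"
  shows "sc 0 = 0" "sc 1 = 1" "sc (x + y) = sc x + sc y" "sc (x - y) = sc x - sc y"
    "sc (x * y) = sc x * sc y" "sc (x ^ n) = sc x ^ n"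
proof -
  show add: "sc (x + y) = sc x + sc y" for x y
    using assms unfolding cplx_alg_def by blast
  show "sc 0 = 0" using add [of 0 0] by simp
  show "sc (x - y) = sc x - sc y" using add [of "x - y" y] by (simp add: eq_diff_eq)
  show mult: "sc (x * y) = sc x * sc y" "sc 1 = 1" for x y
    using assms unfolding cplx_alg_def by blast+
  show "sc (x ^ n) = sc x ^ n" by (induction n) (simp_all add: mult)
qed

lemma cplx_alg_central: "cplx_alg sc \<Longrightarrow> w * sc x = sc x * w"
  unfolding cplx_alg_def by metis

lemma cplx_alg_cancel:
  assumes "cplx_alg sc" "sc t * x = 0" "t \<noteq> 0"
  shows "x = 0"
proof -
  have "x = sc (1 / t * t) * x" using assms(3) by (simp add: cplx_alg_props [OF assms(1)])
  also have "\<dots> = sc (1 / t) * (sc t * x)"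
    by (simp only: cplx_alg_props [OF assms(1)] mult.assoc)
  finally show ?thesis using assms by simp
qed

text \<open>Passing from \<open>p(t)\<close> to \<open>p(2 t) - 2\<^sup>d p(t)\<close> removes the leading term of a polynomial \<open>p\<close> of degree \<open>d\<close>.\<close>

lemma cplx_alg_poly_zero:
  assumes sc: "cplx_alg sc"
    and "\<And>t::nat. 0 < t \<Longrightarrow> (\<Sum>k\<le>N. sc (of_nat t) ^ k * x k) = 0"
    and "k \<le> N"
  shows "x k = 0"
  using assms(2,3)
proof (induction N arbitrary: x k)
  case 0
  then show ?case using "0.prems"(1) [of 1] "0.prems"(2) by simp
next
  case (Suc N)
  define d where "d k = (2::complex) ^ k - 2 ^ Suc N" for k
  have dz: "d k \<noteq> 0" if "k \<le> N" for k
  proof -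
    have "(2::nat) ^ k \<noteq> 2 ^ Suc N" using that by (subst power_inject_exp) simp_all
    then have "complex_of_nat (2 ^ k) \<noteq> of_nat (2 ^ Suc N)" by (simp only: of_nat_eq_iff not_False_eq_True)
    then have "(2::complex) ^ k \<noteq> 2 ^ Suc N" by (simp only: of_nat_power of_nat_numeral not_False_eq_True)
    then show ?thesis by (simp only: d_def right_minus_eq not_False_eq_True)
  qed
  have S: "(\<Sum>k\<le>N. sc (of_nat t) ^ k * (sc (d k) * x k)) = 0" if "0 < t" for t :: nat
  proof -
    have "(\<Sum>k\<le>Suc N. sc (of_nat (2 * t)) ^ k * x k) - sc (2 ^ Suc N) * (\<Sum>k\<le>Suc N. sc (of_nat t) ^ k * x k)
      = (\<Sum>k\<le>Suc N. sc (of_nat t) ^ k * (sc (d k) * x k))"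
      unfolding sum_distrib_left sum_subtractf [symmetric]
    proof (rule sum.cong [OF refl])
      fix k
      show "sc (of_nat (2 * t)) ^ k * x k - sc (2 ^ Suc N) * (sc (of_nat t) ^ k * x k)
        = sc (of_nat t) ^ k * (sc (d k) * x k)"
        unfolding cplx_alg_props(6) [OF sc, symmetric] mult.assoc [symmetric]
          cplx_alg_props(5) [OF sc, symmetric] left_diff_distrib [symmetric] cplx_alg_props(4) [OF sc, symmetric]
        by (simp add: d_def power_mult_distrib algebra_simps)
    qed
    moreover have "(\<Sum>k\<le>Suc N. sc (of_nat (2 * t)) ^ k * x k) = 0" "(\<Sum>k\<le>Suc N. sc (of_nat t) ^ k * x k) = 0"
      using that by (simp_all only: Suc.prems(1) [of t] Suc.prems(1) [of "2 * t"] nat_0_less_mult_iff zero_less_numeral)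
    moreover have "sc (d (Suc N)) = 0" by (simp add: d_def cplx_alg_props(1) [OF sc])
    ultimately show ?thesis
      by (simp only: sum.atMost_Suc mult_zero_left mult_zero_right add_0_right diff_self)
  qed
  have low: "x k = 0" if "k \<le> N" for k
    by (rule cplx_alg_cancel [OF sc Suc.IH [of "\<lambda>k. sc (d k) * x k" k, OF S that] dz [OF that]])
  have "x (Suc N) = 0"
    using Suc.prems(1) [of 1] by (simp add: low cplx_alg_props [OF sc])
  then show ?case using low Suc.prems(2) by (cases "k = Suc N") simp_all
qed

section \<open>Block form of the frustration graph\<close>

definition vE :: "int \<Rightarrow> gen" where "vE n = (False, 2 * n)"
definition vc :: "int \<Rightarrow> gen" where "vc i = (if even i then (False, i - 1) else (True, i + 2))"

lemma v_inj [simp]: "vE m = vE n \<longleftrightarrow> m = n" "vc i = vc j \<longleftrightarrow> i = j" "vE n \<noteq> vc i" "vc i \<noteq> vE n"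
  by (auto simp: vE_def vc_def split: if_splits; presburger)+

text \<open>Adjacency for all integer labels, independent of \<open>M\<close>; out-of-range
  generators are handled by setting them to zero.\<close>

definition adj0 :: "gen \<Rightarrow> gen \<Rightarrow> bool" where "adj0 v w \<longleftrightarrow> ffd_edge0 v w \<or> ffd_edge0 w v"

lemma adj0_commute: "adj0 v w \<longleftrightarrow> adj0 w v"
  by (auto simp: adj0_def)

lemma edge_EE: "adj0 (vE m) (vE n) \<longleftrightarrow> \<bar>m - n\<bar> = 1"
  by (simp add: adj0_def vE_def) presburger

lemma edge_Ec: "adj0 (vE n) (vc i) \<longleftrightarrow> i - 2 * n \<in> {-3,-1,0,2}"
  by (cases "even i") (simp add: adj0_def vE_def vc_def; presburger)+

lemma edge_cc: "adj0 (vc i) (vc j) \<longleftrightarrow> i \<noteq> j \<and> \<bar>i - j\<bar> \<le> 3"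
  by (cases "even i"; cases "even j") (simp add: adj0_def vc_def; presburger)+

section \<open>The given algebra as an instance of the block relations\<close>

locale ffd_algebra =
  fixes M :: nat and g :: "gen \<Rightarrow> 'a::ring_1" and sc :: "complex \<Rightarrow> 'a" and b :: "gen \<Rightarrow> complex"
  assumes sc: "cplx_alg sc"
    and square: "v \<in> ffd_V M \<Longrightarrow> g v * g v = sc ((b v)\<^sup>2)"
    and anti: "ffd_adj M v w \<Longrightarrow> g v * g w = - (g w * g v)"
    and comm: "v \<in> ffd_V M \<Longrightarrow> w \<in> ffd_V M \<Longrightarrow> v \<noteq> w \<Longrightarrow> \<not> ffd_adj M v w \<Longrightarrow> g v * g w = g w * g v"
    and AC: "2 \<le> m \<Longrightarrow> m \<le> int (M div 2) - 2 \<Longrightarrow>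
           ffd_A M g m * ffd_C M g (m + 1) = ffd_C M g m * ffd_A M g (m + 2)"
begin

definition g0 :: "gen \<Rightarrow> 'a" where "g0 v = (if v \<in> ffd_V M then g v else 0)"
definition E :: "int \<Rightarrow> 'a" where "E n = g0 (vE n)"
definition c :: "int \<Rightarrow> 'a" where "c i = g0 (vc i)"

lemma g0_anticommutes: "adj0 v w \<Longrightarrow> anticommutes (g0 v) (g0 w)"
  using anti [of v w] by (auto simp: g0_def anticommutes_def ffd_adj_def adj0_def)

lemma g0_commutes: "v \<noteq> w \<Longrightarrow> \<not> adj0 v w \<Longrightarrow> commutes (g0 v) (g0 w)"
  using comm [of v w] by (auto simp: g0_def commutes_def ffd_adj_def adj0_def)

lemma g0_sq: "commutes (g0 v * g0 v) x"
  using cplx_alg_central [OF sc] square by (simp add: g0_def commutes_def)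

lemma V_E: "vE n \<in> ffd_V M \<longleftrightarrow> 1 \<le> n \<and> 2 * n \<le> int M"
  by (auto simp: ffd_V_def vE_def)

lemma V_c: "vc i \<in> ffd_V M \<longleftrightarrow> -1 \<le> i \<and> i \<noteq> 0 \<and>
    (if even i then i \<le> int M + 1 else i < 2 * int (M div 2))"
  by (auto simp: ffd_V_def vc_def) presburger+

lemma A_eq: "ffd_A M g m = E m * c (2*m-2) + E (m-1) * c (2*m-1)"
  by (simp add: ffd_A_def ffd_h_def ffd_hb_def E_def c_def g0_def vE_def vc_def add.commute)

lemma C_eq: "ffd_C M g m = blockC c m"
  by (simp add: ffd_C_def ffd_h_def ffd_hb_def blockC_def c_def g0_def vc_def add.commute)

text \<open>Outside the assumed range of \<open>m\<close> a factor vanishes on each side, because it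
  involves generators below the first or above the last one.\<close>

lemma AC_all: "ffd_A M g m * ffd_C M g (m + 1) = ffd_C M g m * ffd_A M g (m + 2)"
proof -
  consider "m \<le> 1" | "2 \<le> m" "m \<le> int (M div 2) - 2" | "int (M div 2) - 1 \<le> m" by linarith
  then show ?thesis
  proof cases
    case 1
    then have "c (2*m-2) = 0" "E (m-1) = 0" by (auto simp: c_def E_def g0_def V_c V_E)
    then show ?thesis by (simp add: A_eq C_eq blockC_def)
  next
    case 2
    then show ?thesis by (rule AC)
  next
    case 3
    moreover have "int M \<le> 2 * int (M div 2) + 1" by presburger
    ultimately have "c (2*m+3) = 0" "E (m+2) = 0" by (simp_all add: c_def E_def g0_def V_c V_E)
    then show ?thesis by (simp add: A_eq C_eq blockC_def algebra_simps)
  qed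
qed

sublocale ffd_blocks E c
proof
  \<comment> \<open>The two forms of \<open>A\<close> differ only in the order of two commuting
    factors.\<close>
  have A: "ffd_A M g m = blockA E c m" for m
  proof -
    have "commutes (g0 (vE (m-1))) (g0 (vc (2*m-1)))"
      by (rule g0_commutes) (simp_all add: edge_Ec)
    then show ?thesis by (simp add: A_eq blockA_def commutes_def E_def c_def)
  qed
  show "blockA E c m * blockC c (m+1) = blockC c m * blockA E c (m+2)" for m
    using AC_all by (simp add: A C_eq)
  show "n < 0 \<Longrightarrow> E n = 0" "i < -1 \<Longrightarrow> c i = 0" for n i
    by (auto simp: E_def c_def g0_def V_E V_c)
  show "commutes (E n * E n) x" "commutes (c i * c i) x" for n i x
    by (simp_all add: E_def c_def g0_sq)
qed (auto simp: E_def c_def edge_EE edge_Ec edge_cc intro!: g0_anticommutes g0_commutes)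

section \<open>Deletion recursion in block form\<close>

definition block_poly :: "'a \<Rightarrow> int set \<Rightarrow> int set \<Rightarrow> 'a" where
  "block_poly z S T = indep_poly M g z (vE ` S \<union> vc ` T)"

lemma block_poly_remove:
  assumes z: "\<And>y. y * z = z * y" and x: "x \<in> vE ` S \<union> vc ` T"
    and S': "\<And>n. n \<in> S' \<longleftrightarrow> n \<in> S \<and> vE n \<noteq> x \<and> \<not> adj0 x (vE n)"
    and T': "\<And>i. i \<in> T' \<longleftrightarrow> i \<in> T \<and> vc i \<noteq> x \<and> \<not> adj0 x (vc i)"
  shows "block_poly z S T = indep_poly M g z (vE ` S \<union> vc ` T - {x}) + z * (g0 x * block_poly z S' T')"
proof (cases "x \<in> ffd_V M")
  case True
  have "indep_poly M g z (vE ` S \<union> vc ` T - {x} - {y. ffd_adj M x y}) = block_poly z S' T'"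
    unfolding block_poly_def using True
    by (intro indep_poly_cong) (auto simp: S' T' ffd_adj_def adj0_def)
  then show ?thesis
    using indep_poly_remove [where g = g and W = "vE ` S \<union> vc ` T", OF z _ True x] comm True
    by (simp add: g0_def block_poly_def)
next
  case False
  then show ?thesis
    unfolding block_poly_def by (auto simp: g0_def intro: indep_poly_cong)
qed

lemma block_poly_remove_E:
  assumes "\<And>y. y * z = z * y" "n \<in> S"
    and "S1 = S - {n}" "S2 = {m \<in> S. 1 < \<bar>m - n\<bar>}" "T2 = {i \<in> T. i - 2 * n \<notin> {-3,-1,0,2}}"
  shows "block_poly z S T = block_poly z S1 T + z * (E n * block_poly z S2 T2)"
proof -
  have "vE ` S \<union> vc ` T - {vE n} = vE ` S1 \<union> vc ` T" using assms(3) by auto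
  then show ?thesis
    by (subst block_poly_remove [of z "vE n" S T S2 T2, OF assms(1)])
       (use assms in \<open>auto simp: block_poly_def E_def edge_EE edge_Ec\<close>)
qed

lemma block_poly_remove_c:
  assumes "\<And>y. y * z = z * y" "i \<in> T"
    and "T1 = T - {i}" "S2 = {n \<in> S. i - 2 * n \<notin> {-3,-1,0,2}}" "T2 = {j \<in> T. 3 < \<bar>i - j\<bar>}"
  shows "block_poly z S T = block_poly z S T1 + z * (c i * block_poly z S2 T2)"
proof -
  have "vE ` S \<union> vc ` T - {vc i} = vE ` S \<union> vc ` T1" using assms(3) by auto
  then show ?thesis
    by (subst block_poly_remove [of z "vc i" S T S2 T2, OF assms(1)])
       (use assms in \<open>auto simp: block_poly_def c_def edge_cc edge_Ec adj0_commute [of "vc i" "vE _"]\<close>)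
qed

definition Q :: "'a \<Rightarrow> int \<Rightarrow> 'a" where "Q z n = block_poly z {..n} {..2*n}"

lemma block_charge:
  assumes z: "\<And>y. y * z = z * y"
  shows "block_charge E c z (Q z)"
proof
  fix n :: int
  show "y * z = z * y" for y by (rule z)
  show "Q z n = 1" if "n < 0"
    unfolding Q_def block_poly_def using that by (intro indep_poly_empty) (auto simp: V_E V_c)
  note r = block_poly_remove_E [OF z] block_poly_remove_c [OF z]
  have 1: "Q z n = block_poly z {..n} {..2*n-1} + z * (c (2*n) * Q z (n-2))"
    unfolding Q_def by (rule r(2)) (auto, (presburger+)?)
  have 2: "block_poly z {..n} {..2*n-1} = block_poly z {..n} {..2*(n-1)} + z * (c (2*n-1) * block_poly z {..n-1} {..2*n-5})"
    by (rule r(2)) (auto, (presburger+)?)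
  have 3: "block_poly z {..n} {..2*(n-1)} = block_poly z {..n-1} {..2*(n-1)} + z * (E n * block_poly z {..n-2} (insert (2*n-2) {..2*n-4}))"
    unfolding Q_def by (rule r(1)) (auto, (presburger+)?)
  have 4: "block_poly z {..n-2} (insert (2*n-2) {..2*n-4}) = Q z (n-2) + z * (c (2*n-2) * Q z (n-3))"
    unfolding Q_def by (rule r(2)) (auto, (presburger+)?)
  have 5: "block_poly z {..n-1} {..2*n-5} = block_poly z {..n-2} {..2*n-5} + z * (E (n-1) * Q z (n-3))"
    unfolding Q_def by (rule r(1)) (auto, (presburger+)?)
  \<comment> \<open>Used backwards, to express the polynomial without \<open>c (2*n-4)\<close>
    through \<open>Q z (n-2)\<close>. The resulting minus sign is absorbed when
    \<open>c (2*n-1)\<close> and \<open>c (2*n-4)\<close> are exchanged to form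
    \<open>C (n-1)\<close>.\<close>
  have 6: "Q z (n-2) = block_poly z {..n-2} {..2*n-5} + z * (c (2*n-4) * Q z (n-4))"
    unfolding Q_def by (rule r(2)) (auto, (presburger+)?)
  have 7: "anticommutes (c (2*n-1)) (c (2*n-4))" by (rule cc_anticommutes) simp_all
  have "Q z n = Q z (n-1) + z * (E n * (Q z (n-2) + z * (c (2*n-2) * Q z (n-3))))
      + z * (c (2*n-1) * (Q z (n-2) - z * (c (2*n-4) * Q z (n-4)) + z * (E (n-1) * Q z (n-3))))
      + z * (c (2*n) * Q z (n-2))"
    unfolding 1 2 3 4 5 Q_def [of z "n-1", symmetric] using 6 by (simp add: algebra_simps)
  also have "\<dots> = Q z (n-1) + z * (K n * Q z (n-2) + z * (A n * Q z (n-3)) + z * (C (n-1) * Q z (n-4)))"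
  proof -
    have "y * (z * w) = z * (y * w)" for y w
      by (simp add: z mult.assoc [symmetric])
    note zc = this [of "E _"] this [of "c _"]
    have "c (2*n-1) * (c (2*n-4) * w) = - (c (2*n-4) * (c (2*n-1) * w))" for w
      using 7 by (simp add: anticommutes_def mult.assoc [symmetric])
    then show ?thesis
      by (simp add: blockK_def blockA_def blockC_def zc algebra_simps)
  qed
  finally show "Q z n = Q z (n-1) + z * (K n * Q z (n-2) + z * (A n * Q z (n-3)) + z * (C (n-1) * Q z (n-4)))" .
qed

lemma Q_eq:
  assumes "card (ffd_V M) \<le> N"
  shows "Q z (int M + 1) = (\<Sum>k\<le>N. z ^ k * ffd_Q M g k)"
proof -
  have "v \<in> vE ` {..int M + 1} \<union> vc ` {..2 * (int M + 1)}" if "v \<in> ffd_V M" for v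
    using that unfolding ffd_V_def
  proof (elim UnE CollectE exE conjE)
    fix j assume j: "v = (False, j)" "1 \<le> j" "j \<le> int M"
    then have "v = (if even j then vE (j div 2) else vc (j + 1))"
      by (auto simp: vE_def vc_def)
    then show ?thesis using j by (auto split: if_splits)
  next
    fix m assume m: "v = (True, 2 * m + 1)" "0 \<le> m" "m \<le> int (M div 2)"
    then have "v = vc (2 * m - 1)" by (simp add: vc_def)
    then show ?thesis using m by auto
  qed
  then have "Q z (int M + 1) = indep_poly M g z (ffd_V M)"
    unfolding Q_def block_poly_def by (intro indep_poly_cong) auto
  then show ?thesis by (simp add: indep_poly_eq_sum_ffd_Q [OF assms])
qed

section \<open>Commutation of the charges\<close>

lemma Q_commute:
  assumes "0 < s" "0 < t"
  shows "commutes (Q (sc (of_nat s)) n) (Q (sc (of_nat t)) n)"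
proof -
  interpret p: block_charge_pair E c "sc (of_nat s)" "sc (of_nat t)" "Q (sc (of_nat s))" "Q (sc (of_nat t))"
  proof (intro block_charge_pair.intro block_charge cplx_alg_central [OF sc] block_charge_pair_axioms.intro)
    fix x :: 'a
    show "x = 0" if "x + x = 0"
      by (rule cplx_alg_cancel [OF sc, of 2])
         (use that cplx_alg_props(2) [OF sc] cplx_alg_props(3) [OF sc, of 1 1] in \<open>simp_all add: mult_2\<close>)
    show "x = 0" if "(sc (of_nat s) + sc (of_nat t)) * x = 0"
    proof (rule cplx_alg_cancel [OF sc])
      show "sc (of_nat (s + t)) * x = 0"
        using that by (simp add: cplx_alg_props [OF sc])
      \<comment> \<open>Positive integer parameters are chosen so that \<open>u + v\<close> is an
        invertible scalar.\<close>
      show "complex_of_nat (s + t) \<noteq> 0"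
        using assms unfolding of_nat_eq_0_iff by simp
    qed
  qed
  show ?thesis using p.q_commute by (simp add: commutes_def)
qed

text \<open>The commutator of the generating functions is a polynomial in each parameter and
  vanishes at all positive integers. Coefficients are extracted first in \<open>s\<close>, then in
  \<open>t\<close>; the bound \<open>N\<close> is padded so that it covers both \<open>k\<close> and
  \<open>l\<close>.\<close>

lemma ffd_Q_commute: "ffd_Q M g k * ffd_Q M g l = ffd_Q M g l * ffd_Q M g k"
proof -
  define N where "N = card (ffd_V M) + k + l"
  let ?z = "\<lambda>t::nat. sc (of_nat t)" and ?Q = "ffd_Q M g"
  have pc: "y * ?z t ^ i = ?z t ^ i * y" for y t i
    by (rule power_commuting_commutes [symmetric]) (simp add: cplx_alg_central [OF sc])
  have Q: "Q (?z t) (int M + 1) = (\<Sum>k\<le>N. ?z t ^ k * ?Q k)" for t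
    by (rule Q_eq) (simp add: N_def)
  have 1: "commutator (?Q i) (Q (?z t) (int M + 1)) = 0" if "0 < t" "i \<le> N" for i t
  proof (rule cplx_alg_poly_zero [OF sc _ that(2)])
    fix s :: nat assume "0 < s"
    then have "commutator (Q (?z s) (int M + 1)) (Q (?z t) (int M + 1)) = 0"
      using Q_commute that by (simp add: commutes_def)
    moreover have "commutator (\<Sum>k\<le>N. ?z s ^ k * ?Q k) w = (\<Sum>i\<le>N. ?z s ^ i * commutator (?Q i) w)" for w
      by (simp add: sum_distrib_left sum_distrib_right sum_subtractf [symmetric] right_diff_distrib mult.assoc [symmetric] pc [of w])
    ultimately show "(\<Sum>i\<le>N. ?z s ^ i * commutator (?Q i) (Q (?z t) (int M + 1))) = 0"
      by (simp add: Q [of s])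
  qed
  have "commutator (?Q k) (?Q l) = 0"
  proof (rule cplx_alg_poly_zero [OF sc, where x = "\<lambda>i. commutator (?Q k) (?Q i)" and N = N])
    fix t :: nat assume "0 < t"
    moreover have "commutator w (\<Sum>k\<le>N. ?z t ^ k * ?Q k) = (\<Sum>i\<le>N. ?z t ^ i * commutator w (?Q i))" for w
      by (simp add: sum_distrib_left sum_distrib_right sum_subtractf [symmetric] right_diff_distrib mult.assoc [symmetric] pc [of w])
    ultimately show "(\<Sum>i\<le>N. ?z t ^ i * commutator (?Q k) (?Q i)) = 0"
      using 1 [of t k] by (simp add: Q N_def)
  qed (simp add: N_def)
  then show ?thesis by simp
qed

end

theorem theorem2:
  fixes M :: nat and g :: "gen \<Rightarrow> 'a::ring_1" and sc :: "complex \<Rightarrow> 'a"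
    and b :: "gen \<Rightarrow> complex"
  assumes "M \<ge> 1"
    and "cplx_alg sc"
    and "\<And>v. v \<in> ffd_V M \<Longrightarrow> g v * g v = sc ((b v)\<^sup>2)"
    and "\<And>u v. ffd_adj M u v \<Longrightarrow> g u * g v = - (g v * g u)"
    and "\<And>u v. u \<in> ffd_V M \<Longrightarrow> v \<in> ffd_V M \<Longrightarrow> u \<noteq> v \<Longrightarrow> \<not> ffd_adj M u v
           \<Longrightarrow> g u * g v = g v * g u"
    and "\<And>m. 2 \<le> m \<Longrightarrow> m \<le> int (M div 2) - 2 \<Longrightarrow>
           ffd_A M g m * ffd_C M g (m + 1) = ffd_C M g m * ffd_A M g (m + 2)"
  shows "ffd_Q M g k * ffd_Q M g l = ffd_Q M g l * ffd_Q M g k"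
proof -
  interpret ffd_algebra M g sc b
    by unfold_locales (fact assms)+
  show ?thesis by (rule ffd_Q_commute)
qed

end
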